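(* Let $(\Omega,\mathcal F,\mathbb P)$ be a probability space with a filtration $(\mathcal F_t)_{t\ge0}$, and let $(X_t)_{t\ge1}$ be adapted to $(\mathcal F_t)_{t\ge0}$ with $0\le X_t\le1$ a.s. for all $t$. Define $p_t:=\mathbb E_{\mathbb P}[X_{t+1}\mid\mathcal F_t]$ for $t\ge0$ and $\bar X_n:=\frac1n\sum_{t=1}^nX_t$. If $p_t\to p_\infty$ a.s. for some random variable $p_\infty$, then $\bar X_n\to p_\infty$ a.s. *)

theory Defs
  imports "HOL-Probability.Probability"
begin

definition sample_mean :: "(nat \<Rightarrow> 'a \<Rightarrow> real) \<Rightarrow> nat \<Rightarrow> 'a \<Rightarrow> real" where
  "sample_mean X n \<omega> = (1 / real n) * (\<Sum>t=1..n. X t \<omega>)"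

text \<open>Conditional expectations are determined only up to null sets. The library function
  \<^const>\<open>real_cond_exp\<close> selects one representative; the predicate below describes all of them.\<close>

definition cond_exp_version :: "'a measure \<Rightarrow> 'a measure \<Rightarrow> ('a \<Rightarrow> real) \<Rightarrow> ('a \<Rightarrow> real) \<Rightarrow> bool" where
  "cond_exp_version M G f g \<longleftrightarrow>
     g \<in> borel_measurable G \<and> (AE \<omega> in M. g \<omega> = real_cond_exp M G f \<omega>)"

end

theory Submission
  imports Defs "HOL-Library.Discrete_Functions" "HOL-Real_Asymp.Real_Asymp"
begin

text \<open>
  Write \<open>X (t + 1) = D t + p t\<close>. Since \<open>p t\<close> converges almost surely, so do its Cesaro means, with
  the same limit (\<open>tendsto_cesaro_mean\<close>), so it remains to show that the means of the martingale
  differences \<open>D t\<close> tend to \<open>0\<close> almost surely.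

  The \<open>D t\<close> are almost surely bounded by \<open>1\<close>, and they are pairwise orthogonal in \<open>L\<^sup>2\<close>, because \<open>D i\<close> is
  \<open>F j\<close>-measurable for \<open>i < j\<close> and \<open>D j\<close> has vanishing conditional expectation given \<open>F j\<close>.
  For such variables an elementary strong law holds (\<open>AE_tendsto_mean_orthogonal\<close>).
  The partial sum \<open>S n\<close> satisfies \<open>E[(S n)\<^sup>2] \<le> n\<close>, so \<open>E[(S (k\<^sup>2) / k\<^sup>2)\<^sup>2] \<le> 1 / k\<^sup>2\<close>, which is
  summable, and hence \<open>S (k\<^sup>2) / k\<^sup>2\<close> tends to \<open>0\<close> almost surely. For \<open>k\<^sup>2 \<le> n < (k + 1)\<^sup>2\<close> the sums
  \<open>S n\<close> and \<open>S (k\<^sup>2)\<close> differ by at most \<open>2 k\<close>, which is negligible against \<open>n\<close>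
  (\<open>tendsto_mean_along_squares\<close>).
\<close>

section \<open>Means of real sequences\<close>

lemma filterlim_floor_sqrt_at_top: "filterlim floor_sqrt at_top sequentially"
  by (auto simp: filterlim_at_top eventually_sequentially intro!: le_floor_sqrtI exI[of _ "_\<^sup>2"])

lemma tendsto_mean_along_squares:
  fixes d :: "nat \<Rightarrow> real"
  assumes bound: "\<And>t. \<bar>d t\<bar> \<le> C"
    and squares: "(\<lambda>k. (\<Sum>t<k\<^sup>2. d t) / real (k\<^sup>2)) \<longlonglongrightarrow> 0"
  shows "(\<lambda>n. (\<Sum>t<n. d t) / real n) \<longlonglongrightarrow> 0"
proof -
  define b where "b = (\<lambda>k. \<bar>(\<Sum>t<k\<^sup>2. d t) / real (k\<^sup>2)\<bar> + 2 * C / real k)"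
  have "(\<lambda>k. 2 * C / real k) \<longlonglongrightarrow> 0"
    by real_asymp
  then have "b \<longlonglongrightarrow> 0"
    unfolding b_def using tendsto_add[OF tendsto_rabs_zero[OF squares]] by fastforce
  then have lim: "(\<lambda>n. b (floor_sqrt n)) \<longlonglongrightarrow> 0"
    by (rule filterlim_compose[OF _ filterlim_floor_sqrt_at_top])
  have C: "C \<ge> 0"
    using bound[of 0] by linarith
  have le: "norm ((\<Sum>t<n. d t) / real n) \<le> b (floor_sqrt n)" if "n > 0" for n
  proof -
    define k where "k = floor_sqrt n"
    have k: "k > 0" "k\<^sup>2 \<le> n"
      using that by (simp_all add: k_def)
    have "n < (Suc k)\<^sup>2"
      unfolding k_def by (rule Suc_floor_sqrt_power2_gt)
    then have gap: "n - k\<^sup>2 \<le> 2 * k"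
      by (simp add: power2_eq_square)
    have split: "(\<Sum>t<n. d t) = (\<Sum>t<k\<^sup>2. d t) + (\<Sum>t=k\<^sup>2..<n. d t)"
      using k(2) by (simp add: sum.atLeastLessThan_concat lessThan_atLeast0)
    have "\<bar>\<Sum>t=k\<^sup>2..<n. d t\<bar> \<le> (\<Sum>t=k\<^sup>2..<n. C)"
      by (rule order_trans[OF sum_abs sum_mono]) (rule bound)
    also have "\<dots> = real (n - k\<^sup>2) * C"
      by simp
    also have "\<dots> \<le> real (2 * k) * C"
      using gap C by (intro mult_right_mono of_nat_mono)
    finally have "\<bar>\<Sum>t<n. d t\<bar> \<le> \<bar>\<Sum>t<k\<^sup>2. d t\<bar> + 2 * C * real k"
      unfolding split by (simp add: mult_ac)
    then have "\<bar>\<Sum>t<n. d t\<bar> / real n \<le> (\<bar>\<Sum>t<k\<^sup>2. d t\<bar> + 2 * C * real k) / real (k\<^sup>2)"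
      using k C by (intro frac_le of_nat_mono) auto
    also have "\<dots> = b k"
      using k(1) by (simp add: b_def field_simps power2_eq_square)
    finally show ?thesis
      by (simp add: k_def)
  qed
  show ?thesis
    by (rule Lim_null_comparison[OF _ lim])
      (use le in \<open>auto intro: eventually_mono[OF eventually_gt_at_top[of 0]]\<close>)
qed

lemma tendsto_cesaro_mean_0:
  fixes f :: "nat \<Rightarrow> real"
  assumes "f \<longlonglongrightarrow> 0"
  shows "(\<lambda>n. (\<Sum>t<n. f t) / real n) \<longlonglongrightarrow> 0"
proof (rule LIMSEQ_I)
  fix e :: real
  assume e: "e > 0"
  obtain N where N: "\<And>t. t \<ge> N \<Longrightarrow> \<bar>f t\<bar> < e / 2"
    using LIMSEQ_D[OF assms, of "e / 2"] e by auto
  define A where "A = (\<Sum>t<N. \<bar>f t\<bar>)"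
  have "(\<lambda>n. A / real n) \<longlonglongrightarrow> 0"
    by real_asymp
  then obtain N' where N': "\<And>n. n \<ge> N' \<Longrightarrow> \<bar>A / real n\<bar> < e / 2"
    using LIMSEQ_D[of "\<lambda>n. A / real n" 0 "e / 2"] e by auto
  have "norm ((\<Sum>t<n. f t) / real n - 0) < e" if n: "n \<ge> max (Suc N) N'" for n
  proof -
    have "\<bar>\<Sum>t<n. f t\<bar> \<le> (\<Sum>t<n. \<bar>f t\<bar>)"
      by (rule sum_abs)
    also have "\<dots> = A + (\<Sum>t=N..<n. \<bar>f t\<bar>)"
      using n by (simp add: A_def sum.atLeastLessThan_concat lessThan_atLeast0)
    also have "\<dots> \<le> A + (\<Sum>t=N..<n. e / 2)"
      using N by (intro add_left_mono sum_mono) (auto intro: less_imp_le)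
    also have "\<dots> \<le> A + real n * (e / 2)"
      using e by simp
    finally have "\<bar>\<Sum>t<n. f t\<bar> / real n \<le> A / real n + e / 2"
      using n by (simp add: field_simps)
    moreover have "A / real n < e / 2"
      using N'[of n] n by linarith
    ultimately show ?thesis
      unfolding diff_0_right real_norm_def abs_divide abs_of_nat by linarith
  qed
  then show "\<exists>no. \<forall>n\<ge>no. norm ((\<Sum>t<n. f t) / real n - 0) < e"
    by blast
qed

lemma tendsto_cesaro_mean:
  fixes f :: "nat \<Rightarrow> real"
  assumes "f \<longlonglongrightarrow> L"
  shows "(\<lambda>n. (\<Sum>t<n. f t) / real n) \<longlonglongrightarrow> L"
proof -
  have "(\<lambda>n. (\<Sum>t<n. f t - L) / real n + L) \<longlonglongrightarrow> 0 + L"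
    using assms by (intro tendsto_add tendsto_cesaro_mean_0 tendsto_const) (simp add: LIM_zero)
  moreover have "\<forall>\<^sub>F n in sequentially. (\<Sum>t<n. f t - L) / real n + L = (\<Sum>t<n. f t) / real n"
    using eventually_gt_at_top[of 0]
    by eventually_elim (simp add: sum_subtractf field_simps)
  ultimately show ?thesis
    by (simp add: tendsto_cong)
qed

section \<open>A strong law for bounded orthogonal random variables\<close>

lemma AE_tendsto_0_if_summable_integral:
  fixes f :: "nat \<Rightarrow> 'a \<Rightarrow> real"
  assumes int: "\<And>k. integrable M (f k)"
    and nonneg: "\<And>k x. 0 \<le> f k x"
    and summable: "summable (\<lambda>k. integral\<^sup>L M (f k))"
  shows "AE x in M. (\<lambda>k. f k x) \<longlonglongrightarrow> 0"
proof -
  have [measurable]: "f k \<in> borel_measurable M" for k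
    using int by auto
  have "(\<integral>\<^sup>+x. (\<Sum>k. ennreal (f k x)) \<partial>M) = (\<Sum>k. \<integral>\<^sup>+x. ennreal (f k x) \<partial>M)"
    by (rule nn_integral_suminf) measurable
  also have "\<dots> = (\<Sum>k. ennreal (integral\<^sup>L M (f k)))"
    using int nonneg by (simp add: nn_integral_eq_integral)
  also have "\<dots> \<noteq> \<infinity>"
    using summable nonneg by (simp add: ennreal_suminf_neq_top)
  finally have "AE x in M. (\<Sum>k. ennreal (f k x)) \<noteq> \<infinity>"
    by (intro nn_integral_PInf_AE) measurable
  then show ?thesis
    by eventually_elim (auto intro!: summable_LIMSEQ_zero summable_suminf_not_top nonneg)
qed

lemma (in prob_space) integrable_AE_bounded:
  fixes f :: "'a \<Rightarrow> real"
  assumes "f \<in> borel_measurable M" "AE x in M. \<bar>f x\<bar> \<le> C"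
  shows "integrable M f"
  using assms by (intro integrable_const_bound[where B = C]) auto

lemma (in prob_space) integrable_mult_AE_bounded:
  fixes f g :: "'a \<Rightarrow> real"
  assumes [measurable]: "f \<in> borel_measurable M" "g \<in> borel_measurable M"
    and f: "AE x in M. \<bar>f x\<bar> \<le> C" and g: "AE x in M. \<bar>g x\<bar> \<le> C"
  shows "integrable M (\<lambda>x. f x * g x)"
proof (rule integrable_AE_bounded)
  show "AE x in M. \<bar>f x * g x\<bar> \<le> C * C"
    using f g by eventually_elim (auto simp: abs_mult intro!: mult_mono)
qed measurable

lemma (in prob_space) expectation_square_sum_orthogonal:
  fixes D :: "nat \<Rightarrow> 'a \<Rightarrow> real"
  assumes meas[measurable]: "\<And>t. D t \<in> borel_measurable M"
    and bound: "\<And>t. AE x in M. \<bar>D t x\<bar> \<le> C"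
    and orth: "\<And>i j. i < j \<Longrightarrow> expectation (\<lambda>x. D i x * D j x) = 0"
  shows "integrable M (\<lambda>x. (\<Sum>t<n. D t x)\<^sup>2)"
    and "expectation (\<lambda>x. (\<Sum>t<n. D t x)\<^sup>2) \<le> real n * C\<^sup>2"
proof -
  have int: "integrable M (\<lambda>x. D i x * D j x)" for i j
    by (rule integrable_mult_AE_bounded) (auto intro: bound)
  have square: "(\<lambda>x. (\<Sum>t<n. D t x)\<^sup>2) = (\<lambda>x. \<Sum>i<n. \<Sum>j<n. D i x * D j x)"
    by (simp add: power2_eq_square sum_product)
  show "integrable M (\<lambda>x. (\<Sum>t<n. D t x)\<^sup>2)"
    unfolding square by (intro Bochner_Integration.integrable_sum int)
  have off_diag: "expectation (\<lambda>x. D i x * D j x) = 0" if "i \<noteq> j" for i j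
    using orth[of i j] orth[of j i] that by (cases i j rule: linorder_cases) (auto simp: mult.commute)
  have diag: "expectation (\<lambda>x. D i x * D i x) \<le> C\<^sup>2" for i
  proof -
    have "AE x in M. D i x * D i x \<le> C\<^sup>2"
      using bound[of i]
      by eventually_elim (metis abs_ge_zero power2_abs power2_eq_square power_mono)
    then have "expectation (\<lambda>x. D i x * D i x) \<le> expectation (\<lambda>x. C\<^sup>2)"
      by (intro integral_mono_AE int) auto
    then show ?thesis
      by (simp add: prob_space)
  qed
  have "expectation (\<lambda>x. (\<Sum>t<n. D t x)\<^sup>2) = (\<Sum>i<n. \<Sum>j<n. expectation (\<lambda>x. D i x * D j x))"
    unfolding square by (simp add: int)
  also have "\<dots> = (\<Sum>i<n. \<Sum>j<n. if j = i then expectation (\<lambda>x. D i x * D i x) else 0)"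
    by (intro sum.cong refl) (auto simp: off_diag)
  also have "\<dots> = (\<Sum>i<n. expectation (\<lambda>x. D i x * D i x))"
    by simp
  also have "\<dots> \<le> (\<Sum>i<n. C\<^sup>2)"
    by (intro sum_mono diag)
  finally show "expectation (\<lambda>x. (\<Sum>t<n. D t x)\<^sup>2) \<le> real n * C\<^sup>2"
    by simp
qed

text \<open>
  Only pairwise orthogonality is used. The variance bound gives convergence along the squares, and
  the uniform bound on the variables controls the oscillation between consecutive squares.
\<close>

lemma (in prob_space) AE_tendsto_mean_orthogonal:
  fixes D :: "nat \<Rightarrow> 'a \<Rightarrow> real"
  assumes meas: "\<And>t. D t \<in> borel_measurable M"
    and bound: "\<And>t. AE x in M. \<bar>D t x\<bar> \<le> C"
    and orth: "\<And>i j. i < j \<Longrightarrow> expectation (\<lambda>x. D i x * D j x) = 0"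
  shows "AE x in M. (\<lambda>n. (\<Sum>t<n. D t x) / real n) \<longlonglongrightarrow> 0"
proof -
  note moment = expectation_square_sum_orthogonal[where D = D, OF meas bound orth]
  define Z where "Z = (\<lambda>k x. ((\<Sum>t<k\<^sup>2. D t x) / real (k\<^sup>2))\<^sup>2)"
  have Z_eq: "Z k = (\<lambda>x. (\<Sum>t<k\<^sup>2. D t x)\<^sup>2 / (real (k\<^sup>2))\<^sup>2)" for k
    by (simp add: Z_def power_divide)
  have Z_int: "integrable M (Z k)" for k
    unfolding Z_eq by (intro integrable_divide moment(1))
  \<comment> \<open>For \<open>k = 0\<close> both sides are \<open>0\<close>, as \<open>x / 0 = 0\<close> and \<open>inverse 0 = 0\<close>.\<close>
  have Z_le: "expectation (Z k) \<le> C\<^sup>2 * inverse (real k ^ 2)" for k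
  proof -
    have "expectation (Z k) = expectation (\<lambda>x. (\<Sum>t<k\<^sup>2. D t x)\<^sup>2) / (real (k\<^sup>2))\<^sup>2"
      unfolding Z_eq by simp
    also have "\<dots> \<le> real (k\<^sup>2) * C\<^sup>2 / (real (k\<^sup>2))\<^sup>2"
      by (intro divide_right_mono moment(2)) auto
    also have "\<dots> = C\<^sup>2 * inverse (real k ^ 2)"
      by (simp add: field_simps power2_eq_square)
    finally show ?thesis .
  qed
  have "summable (\<lambda>k. C\<^sup>2 * inverse (real k ^ 2))"
    by (intro summable_mult inverse_power_summable) simp
  then have "summable (\<lambda>k. expectation (Z k))"
    by (rule summable_comparison_test'[where N = 0]) (use Z_le in \<open>simp add: Z_def\<close>)
  then have "AE x in M. (\<lambda>k. Z k x) \<longlonglongrightarrow> 0"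
    by (intro AE_tendsto_0_if_summable_integral Z_int) (simp_all add: Z_def)
  moreover have "AE x in M. \<forall>t. \<bar>D t x\<bar> \<le> C"
    using bound by (simp add: AE_all_countable)
  ultimately show ?thesis
  proof eventually_elim
    case (elim x)
    have "(\<lambda>k. (\<Sum>t<k\<^sup>2. D t x) / real (k\<^sup>2)) \<longlonglongrightarrow> 0"
      using tendsto_real_sqrt[OF elim(1)] unfolding Z_def
      by (simp del: power_divide) (rule tendsto_rabs_zero_cancel, simp)
    with elim(2) show ?case
      by (intro tendsto_mean_along_squares) auto
  qed
qed

section \<open>Versions of conditional expectations\<close>

lemma (in prob_space) cond_exp_version_bounded:
  assumes sub: "subalgebra M G" and ver: "cond_exp_version M G f g"
    and f[measurable]: "f \<in> borel_measurable M" and bound: "AE x in M. 0 \<le> f x \<and> f x \<le> 1"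
  shows "AE x in M. 0 \<le> g x \<and> g x \<le> 1"
proof -
  interpret finite_measure_subalgebra M G
    by unfold_locales (rule sub)
  have int: "integrable M f"
    by (rule integrable_AE_bounded[where C = 1]) (use bound in auto)
  have "AE x in M. real_cond_exp M G f x \<ge> 0"
    using bound by (intro real_cond_exp_ge_c[OF int]) auto
  moreover have "AE x in M. real_cond_exp M G f x \<le> 1"
    using bound by (intro real_cond_exp_le_c[OF int]) auto
  ultimately show ?thesis
    using ver unfolding cond_exp_version_def by auto
qed

lemma (in prob_space) cond_exp_version_orthogonal:
  assumes sub: "subalgebra M G" and ver: "cond_exp_version M G f g"
    and f: "f \<in> borel_measurable M" and h: "h \<in> borel_measurable G"
    and int: "integrable M (\<lambda>x. h x * f x)"
  shows "expectation (\<lambda>x. h x * (f x - g x)) = 0"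
proof -
  interpret finite_measure_subalgebra M G
    by unfold_locales (rule sub)
  have [measurable]: "f \<in> borel_measurable M" "h \<in> borel_measurable M" "g \<in> borel_measurable M"
    using f measurable_from_subalg[OF sub] h ver by (auto simp: cond_exp_version_def)
  note cond = real_cond_exp_intg[OF int h f]
  have "expectation (\<lambda>x. h x * (f x - g x)) = expectation (\<lambda>x. h x * f x - h x * real_cond_exp M G f x)"
    by (rule integral_cong_AE)
      (use ver in \<open>auto simp: cond_exp_version_def right_diff_distrib\<close>)
  also have "\<dots> = 0"
    using int cond by simp
  finally show ?thesis .
qed

section \<open>Sample means of an adapted process\<close>

theorem proposition6:
  fixes M :: "'a measure"
    and F :: "nat \<Rightarrow> 'a measure"
    and X p :: "nat \<Rightarrow> 'a \<Rightarrow> real"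
    and p_inf :: "'a \<Rightarrow> real"
  assumes "prob_space M"
    and "filtration (space M) F"
    and "\<And>t. subalgebra M (F t)"
    and "\<And>t. t \<ge> 1 \<Longrightarrow> X t \<in> borel_measurable (F t)"
    and "\<And>t. t \<ge> 1 \<Longrightarrow> AE \<omega> in M. 0 \<le> X t \<omega> \<and> X t \<omega> \<le> 1"
    and "\<And>t. cond_exp_version M (F t) (X (Suc t)) (p t)"
    and "p_inf \<in> borel_measurable M"
    and "AE \<omega> in M. (\<lambda>t. p t \<omega>) \<longlonglongrightarrow> p_inf \<omega>"
  shows "AE \<omega> in M. (\<lambda>n. sample_mean X n \<omega>) \<longlonglongrightarrow> p_inf \<omega>"
proof -
  interpret prob_space M by fact
  interpret filtration "space M" F by fact
  note sub = assms(3) and adapted = assms(4) and range = assms(5) and ver = assms(6)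
  define D where "D = (\<lambda>t \<omega>. X (Suc t) \<omega> - p t \<omega>)"
  have D_eq: "D t \<omega> = X (Suc t) \<omega> - p t \<omega>" for t \<omega>
    by (simp add: D_def)
  have X_meas[measurable]: "X (Suc t) \<in> borel_measurable M" for t
    by (rule measurable_from_subalg[OF sub adapted]) simp
  have p_meas_F: "p t \<in> borel_measurable (F t)" for t
    using ver by (simp add: cond_exp_version_def)
  have [measurable]: "p t \<in> borel_measurable M" for t
    by (rule measurable_from_subalg[OF sub p_meas_F])
  have D_meas[measurable]: "D t \<in> borel_measurable M" for t
    unfolding D_def by measurable
  have X_range: "AE \<omega> in M. 0 \<le> X (Suc t) \<omega> \<and> X (Suc t) \<omega> \<le> 1" for t
    by (rule range) simp
  have D_bound: "AE \<omega> in M. \<bar>D t \<omega>\<bar> \<le> 1" for t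
    using X_range[of t] cond_exp_version_bounded[OF sub ver X_meas X_range, of t]
    by eventually_elim (auto simp: D_eq)
  have orth: "expectation (\<lambda>\<omega>. D i \<omega> * D j \<omega>) = 0" if "i < j" for i j
  proof -
    have mono: "f \<in> borel_measurable (F j)" if "f \<in> borel_measurable (F k)" "k \<le> j" for f :: "'a \<Rightarrow> real" and k
      by (rule measurable_from_subalg[OF _ that(1)])
        (use that(2) in \<open>auto simp: subalgebra_def space_F sets_F_mono\<close>)
    \<comment> \<open>\<open>D i\<close> involves \<open>X (Suc i)\<close>, which is \<open>F j\<close>-measurable because \<open>Suc i \<le> j\<close>.\<close>
    have "D i \<in> borel_measurable (F j)"
      unfolding D_def using that
      by (intro borel_measurable_diff mono[OF adapted] mono[OF p_meas_F]) auto
    moreover have "integrable M (\<lambda>\<omega>. D i \<omega> * X (Suc j) \<omega>)"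
      by (rule integrable_mult_AE_bounded[where C = 1]) (use D_bound X_range[of j] in auto)
    ultimately show ?thesis
      unfolding D_eq[of j] by (intro cond_exp_version_orthogonal[OF sub ver X_meas])
  qed
  have "AE \<omega> in M. (\<lambda>n. (\<Sum>t<n. D t \<omega>) / real n) \<longlonglongrightarrow> 0"
    by (rule AE_tendsto_mean_orthogonal[OF D_meas D_bound orth])
  with assms(8) show ?thesis
  proof eventually_elim
    case (elim \<omega>)
    have "sample_mean X n \<omega> = (\<Sum>t<n. D t \<omega>) / real n + (\<Sum>t<n. p t \<omega>) / real n" for n
    proof -
      have "(\<Sum>t=1..n. X t \<omega>) = (\<Sum>t<n. X (Suc t) \<omega>)"
        by (simp add: sum.atLeast1_atMost_eq)
      then show ?thesis
        by (simp add: sample_mean_def D_eq sum_subtractf diff_divide_distrib)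
    qed
    then show ?case
      using tendsto_add[OF elim(2) tendsto_cesaro_mean[OF elim(1)]] by simp
  qed
qed

end
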